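(* Let $K$ be a commutative ring containing $\mathbb Q$ as a subring, let $\Omega$ be a reference sequence, and let $n>0$ be an integer. Then $$\exp(\mathfrak m_K^{n})=\mathcal M_K^{n}$$ (and hence $\log(\mathcal M_K^{n})=\mathfrak m_K^{n}$), where $\mathfrak m_K^n=\mathfrak m_K^{\Omega,n}=\{\langle h\rangle^\Omega: h\in z^{n+1}K[[z]]\}$ and $\mathcal M_K^n=\mathcal M_K^{\Omega,n}=\{[f]^\Omega: f\in z+z^{n+1}K[[z]]\}$.
   Context: Matrices are indexed by $\mathbb N\times\mathbb N$ with $\mathbb N=\{0,1,2,\dots\}$. A reference sequence is a sequence $\Omega=(\Omega_n)_{n\ge0}$ of non-zero rational numbers with $\Omega_0=\Omega_1=1$. Iteration matrix: for $f\in zK[[z]]$, $[f]^\Omega=([f]^\Omega_{ij})$ is the upper triangular matrix over $K$ determined by $\Omega_i f^i=\sum_{j\ge0}[f]^\Omega_{ij}\,\Omega_j z^j$ for all $i\in\mathbb N$. Infinitesimal iteration matrix: for $h=\sum_{n\ge1}h_nz^n\in zK[[z]]$, $\langle h\rangle^\Omega$ is the upper triangular matrix with entries $\langle h\rangle^\Omega_{ij}=\frac{\Omega_i}{\Omega_j}\,i\,h_{j-i+1}$ for $i\le j$ and $0$ for $i>j$. For a strictly upper triangular matrix $M$ over $K$, $\exp(M)=\sum_{n\ge0}\frac{M^n}{n!}$ and $\log(1+M)=\sum_{n\ge1}(-1)^{n+1}\frac{M^n}{n}$, where $1$ is the identity matrix (each entry is a finite sum); these give mutually inverse bijections between strictly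 upper triangular matrices and upper triangular matrices with all diagonal entries $1$. *)

theory Defs
  imports
    "HOL-Computational_Algebra.Formal_Power_Series"
    "HOL-Library.Groups_Big_Fun"
begin

text \<open>
  That the commutative ring \<open>K\<close> contains \<open>\<rat>\<close> as a subring is expressed by an injective unital
  ring homomorphism from \<^typ>\<open>rat\<close> to \<open>K\<close>; rational scalars act on \<open>K\<close> through it.
\<close>

definition rat_subring :: "(rat \<Rightarrow> 'a::comm_ring_1) \<Rightarrow> bool" where
  "rat_subring \<iota> \<longleftrightarrow>
     inj \<iota> \<and> \<iota> 1 = 1 \<and> (\<forall>x y. \<iota> (x + y) = \<iota> x + \<iota> y) \<and> (\<forall>x y. \<iota> (x * y) = \<iota> x * \<iota> y)"

definition reference_sequence :: "(nat \<Rightarrow> rat) \<Rightarrow> bool" where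
  "reference_sequence \<Omega> \<longleftrightarrow> (\<forall>n. \<Omega> n \<noteq> 0) \<and> \<Omega> 0 = 1 \<and> \<Omega> 1 = 1"


type_synonym 'a matrix = "nat \<Rightarrow> nat \<Rightarrow> 'a"

definition upper_triangular :: "'a::zero matrix \<Rightarrow> bool" where
  "upper_triangular A \<longleftrightarrow> (\<forall>i j. j < i \<longrightarrow> A i j = 0)"

definition strictly_upper_triangular :: "'a::zero matrix \<Rightarrow> bool" where
  "strictly_upper_triangular A \<longleftrightarrow> (\<forall>i j. j \<le> i \<longrightarrow> A i j = 0)"

definition mat_id :: "'a::zero_neq_one matrix" where
  "mat_id = (\<lambda>i j. if i = j then 1 else 0)"

text \<open>
  \<^const>\<open>Sum_any\<close> is the sum over the whole index type of a function with finite support (and \<open>0\<close>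
  if the support is infinite). The supports below are finite for upper triangular factors and, in
  the exponential and logarithm, for strictly upper triangular \<open>M\<close> and \<open>A - 1\<close>.
\<close>

definition mat_mult :: "'a::comm_ring_1 matrix \<Rightarrow> 'a matrix \<Rightarrow> 'a matrix" where
  "mat_mult A B = (\<lambda>i j. Sum_any (\<lambda>k. A i k * B k j))"

primrec mat_power :: "'a::comm_ring_1 matrix \<Rightarrow> nat \<Rightarrow> 'a matrix" where
  "mat_power A 0 = mat_id"
| "mat_power A (Suc n) = mat_mult A (mat_power A n)"

definition mat_exp :: "(rat \<Rightarrow> 'a::comm_ring_1) \<Rightarrow> 'a matrix \<Rightarrow> 'a matrix" where
  "mat_exp \<iota> M = (\<lambda>i j. Sum_any (\<lambda>n. \<iota> (1 / fact n) * mat_power M n i j))"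

text \<open>The argument is the whole matrix \<open>A = 1 + M\<close>, not \<open>M\<close>.\<close>

definition mat_log :: "(rat \<Rightarrow> 'a::comm_ring_1) \<Rightarrow> 'a matrix \<Rightarrow> 'a matrix" where
  "mat_log \<iota> A = (\<lambda>i j. Sum_any (\<lambda>n. if n \<ge> 1
     then \<iota> ((-1) ^ (n + 1) / of_nat n) * mat_power (\<lambda>k l. A k l - mat_id k l) n i j else 0))"

lemma mat_power_eq_0:
  assumes "strictly_upper_triangular M" and "j < i + n"
  shows "mat_power M n i j = 0"
  using assms(2)
proof (induction n arbitrary: i)
  case 0
  then show ?case by (simp add: mat_id_def)
next
  case (Suc n)
  have "M i k * mat_power M n k j = 0" for k
  proof (cases "k \<le> i")
    case True
    then show ?thesis using assms(1) by (simp add: strictly_upper_triangular_def)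
  next
    case False
    then show ?thesis using Suc by simp
  qed
  then show ?case by (simp add: mat_mult_def)
qed


definition iteration_matrix ::
    "(rat \<Rightarrow> 'a::comm_ring_1) \<Rightarrow> (nat \<Rightarrow> rat) \<Rightarrow> 'a fps \<Rightarrow> 'a matrix" where
  "iteration_matrix \<iota> \<Omega> f = (THE A. upper_triangular A \<and>
     (\<forall>i. fps_const (\<iota> (\<Omega> i)) * f ^ i = Abs_fps (\<lambda>j. A i j * \<iota> (\<Omega> j))))"

lemma iteration_matrix_eq:
  assumes \<iota>: "rat_subring \<iota>" and \<Omega>: "reference_sequence \<Omega>" and f: "fps_nth f 0 = 0"
  shows "iteration_matrix \<iota> \<Omega> f = (\<lambda>i j. \<iota> (\<Omega> i / \<Omega> j) * fps_nth (f ^ i) j)"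
  unfolding iteration_matrix_def
proof (rule the_equality)
  have mult: "\<iota> (x * y) = \<iota> x * \<iota> y" and one: "\<iota> 1 = 1" for x y
    using \<iota> by (simp_all add: rat_subring_def)
  have nz: "\<Omega> n \<noteq> 0" for n
    using \<Omega> by (simp add: reference_sequence_def)
  have cancel: "\<iota> (\<Omega> i / \<Omega> j) * \<iota> (\<Omega> j) = \<iota> (\<Omega> i)" for i j
    by (simp add: mult [symmetric] nz)
  show "upper_triangular (\<lambda>i j. \<iota> (\<Omega> i / \<Omega> j) * fps_nth (f ^ i) j) \<and>
    (\<forall>i. fps_const (\<iota> (\<Omega> i)) * f ^ i =
      Abs_fps (\<lambda>j. \<iota> (\<Omega> i / \<Omega> j) * fps_nth (f ^ i) j * \<iota> (\<Omega> j)))"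
  proof (intro conjI allI)
    show "upper_triangular (\<lambda>i j. \<iota> (\<Omega> i / \<Omega> j) * fps_nth (f ^ i) j)"
      using f by (simp add: upper_triangular_def startsby_zero_power_prefix)
    show "fps_const (\<iota> (\<Omega> i)) * f ^ i =
        Abs_fps (\<lambda>j. \<iota> (\<Omega> i / \<Omega> j) * fps_nth (f ^ i) j * \<iota> (\<Omega> j))" for i
    proof (rule fps_ext)
      fix j
      have "\<iota> (\<Omega> i / \<Omega> j) * c * \<iota> (\<Omega> j) = \<iota> (\<Omega> i) * c" for c
        by (simp only: cancel [of i j, symmetric] ac_simps)
      then show "fps_nth (fps_const (\<iota> (\<Omega> i)) * f ^ i) j =
          fps_nth (Abs_fps (\<lambda>j. \<iota> (\<Omega> i / \<Omega> j) * fps_nth (f ^ i) j * \<iota> (\<Omega> j))) j"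
        by simp
    qed
  qed
  fix A
  assume "upper_triangular A \<and>
    (\<forall>i. fps_const (\<iota> (\<Omega> i)) * f ^ i = Abs_fps (\<lambda>j. A i j * \<iota> (\<Omega> j)))"
  then have A: "fps_const (\<iota> (\<Omega> i)) * f ^ i = Abs_fps (\<lambda>j. A i j * \<iota> (\<Omega> j))" for i
    by blast
  have eq: "\<iota> (\<Omega> i) * fps_nth (f ^ i) j = A i j * \<iota> (\<Omega> j)" for i j
  proof -
    have "fps_nth (fps_const (\<iota> (\<Omega> i)) * f ^ i) j = fps_nth (Abs_fps (\<lambda>j. A i j * \<iota> (\<Omega> j))) j"
      by (simp only: A)
    then show ?thesis by simp
  qed
  show "A = (\<lambda>i j. \<iota> (\<Omega> i / \<Omega> j) * fps_nth (f ^ i) j)"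
  proof (intro ext)
    fix i j
    have inv: "\<iota> (\<Omega> j) * \<iota> (1 / \<Omega> j) = 1"
      by (simp add: mult [symmetric] nz one)
    have quot: "\<iota> (\<Omega> i) * \<iota> (1 / \<Omega> j) = \<iota> (\<Omega> i / \<Omega> j)"
      by (simp add: mult [symmetric])
    have "A i j = A i j * (\<iota> (\<Omega> j) * \<iota> (1 / \<Omega> j))"
      by (simp only: inv mult_1_right)
    also have "\<dots> = \<iota> (\<Omega> i) * fps_nth (f ^ i) j * \<iota> (1 / \<Omega> j)"
      by (simp only: eq mult.assoc [symmetric])
    also have "\<dots> = \<iota> (\<Omega> i) * \<iota> (1 / \<Omega> j) * fps_nth (f ^ i) j"
      by (simp only: ac_simps)
    also have "\<dots> = \<iota> (\<Omega> i / \<Omega> j) * fps_nth (f ^ i) j"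
      by (simp only: quot)
    finally show "A i j = \<iota> (\<Omega> i / \<Omega> j) * fps_nth (f ^ i) j" .
  qed
qed

definition inf_iteration_matrix ::
    "(rat \<Rightarrow> 'a::comm_ring_1) \<Rightarrow> (nat \<Rightarrow> rat) \<Rightarrow> 'a fps \<Rightarrow> 'a matrix" where
  "inf_iteration_matrix \<iota> \<Omega> h =
     (\<lambda>i j. if i \<le> j then \<iota> (\<Omega> i / \<Omega> j) * of_nat i * fps_nth h (j - i + 1) else 0)"

definition inf_iteration_matrices ::
    "(rat \<Rightarrow> 'a::comm_ring_1) \<Rightarrow> (nat \<Rightarrow> rat) \<Rightarrow> nat \<Rightarrow> 'a matrix set" where
  "inf_iteration_matrices \<iota> \<Omega> n = {inf_iteration_matrix \<iota> \<Omega> h | h. fps_X ^ (n + 1) dvd h}"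

definition iteration_matrices ::
    "(rat \<Rightarrow> 'a::comm_ring_1) \<Rightarrow> (nat \<Rightarrow> rat) \<Rightarrow> nat \<Rightarrow> 'a matrix set" where
  "iteration_matrices \<iota> \<Omega> n = {iteration_matrix \<iota> \<Omega> f | f. fps_X ^ (n + 1) dvd f - fps_X}"

end

theory Submission
  imports Defs
begin

text \<open>
  Up to the scaling \<open>\<Omega>\<^sub>i / \<Omega>\<^sub>j\<close>, row \<open>i\<close> of \<open>\<langle>h\<rangle>\<close> is \<open>D (z\<^sup>i)\<close> for the derivation
  \<open>D = h d/dz\<close>, so row \<open>i\<close> of \<open>exp \<langle>h\<rangle>\<close> is \<open>E (z\<^sup>i)\<close> with \<open>E = \<Sum>\<^sub>k D\<^sup>k / k!\<close>. By the Leibniz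
  rule \<open>E\<close> is multiplicative, whence \<open>exp \<langle>h\<rangle> = [E z]\<close>. Conversely, the coefficient of \<open>z\<^sup>j\<close> in
  \<open>E z\<close> is \<open>h\<^sub>j\<close> plus an expression in \<open>h\<^sub>i\<close> with \<open>i < j\<close>, so \<open>E z = f\<close> can be solved
  recursively for \<open>h\<close>. The statement on the logarithm follows by substituting a strictly upper
  triangular matrix into the formal identity \<open>log (1 + (exp x - 1)) = x\<close>.
\<close>

section \<open>Rational scalars and divisibility by powers of the variable\<close>

context
  fixes \<iota> :: "rat \<Rightarrow> 'a::comm_ring_1"
  assumes \<iota>: "rat_subring \<iota>"
begin

lemma rat_subring_add: "\<iota> (x + y) = \<iota> x + \<iota> y"
  and rat_subring_mult: "\<iota> (x * y) = \<iota> x * \<iota> y"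
  and rat_subring_1: "\<iota> 1 = 1"
  using \<iota> by (auto simp: rat_subring_def)

lemma rat_subring_0: "\<iota> 0 = 0"
  using rat_subring_add [of 0 0] by simp

lemma rat_subring_sum: "\<iota> (sum g A) = (\<Sum>a\<in>A. \<iota> (g a))"
  by (induction A rule: infinite_finite_induct) (simp_all add: rat_subring_0 rat_subring_add)

lemma rat_subring_of_nat: "\<iota> (of_nat k) = of_nat k"
  by (induction k) (simp_all add: rat_subring_0 rat_subring_1 rat_subring_add)

end

text \<open>Turns the divisibility conditions on h and f - z into vanishing of low coefficients, the
  form in which orders are tracked below.\<close>

lemma fps_X_power_dvd_iff:
  "fps_X ^ m dvd (f :: 'a::comm_ring_1 fps) \<longleftrightarrow> (\<forall>i<m. fps_nth f i = 0)"
proof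
  assume "fps_X ^ m dvd f"
  then obtain g where "f = fps_X ^ m * g" ..
  then show "\<forall>i<m. fps_nth f i = 0"
    by (simp add: fps_X_power_mult_nth)
next
  assume *: "\<forall>i<m. fps_nth f i = 0"
  have "f = fps_X ^ m * fps_shift m f"
    by (rule fps_ext) (use * in \<open>auto simp: fps_X_power_mult_nth\<close>)
  then show "fps_X ^ m dvd f" ..
qed

section \<open>Upper triangular matrices\<close>

text \<open>Column j of \<open>B\<close> vanishes below row j, so the support lies in
  \<open>{..j}\<close> and the product becomes an honest finite sum.\<close>

lemma mat_mult_upper_triangular:
  assumes "upper_triangular B"
  shows "mat_mult A B i j = (\<Sum>k\<le>j. A i k * B k j)"
  unfolding mat_mult_def
proof (rule Sum_any.expand_superset)
  show "{k. A i k * B k j \<noteq> 0} \<subseteq> {..j}"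
    using assms by (force simp: upper_triangular_def not_less [symmetric])
qed simp

lemma upper_triangular_mat_mult:
  assumes "upper_triangular A" "upper_triangular B"
  shows "upper_triangular (mat_mult A B)"
  unfolding upper_triangular_def
proof (intro allI impI)
  fix i j :: nat
  assume "j < i"
  then show "mat_mult A B i j = 0"
    using assms by (simp add: mat_mult_upper_triangular) (simp add: upper_triangular_def)
qed

lemma strictly_upper_triangular_imp_upper_triangular:
  "strictly_upper_triangular M \<Longrightarrow> upper_triangular M"
  by (simp add: strictly_upper_triangular_def upper_triangular_def)

lemma upper_triangular_mat_id: "upper_triangular (mat_id :: 'a::comm_ring_1 matrix)"
  by (simp add: upper_triangular_def mat_id_def)

lemma upper_triangular_mat_power:
  "upper_triangular A \<Longrightarrow> upper_triangular (mat_power A m)"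
  by (induction m) (simp_all add: upper_triangular_mat_id upper_triangular_mat_mult)

lemma mat_mult_assoc:
  assumes B: "upper_triangular B" and C: "upper_triangular C"
  shows "mat_mult (mat_mult A B) C = mat_mult A (mat_mult B C)"
proof (intro ext)
  fix i j
  \<comment> \<open>The natural bound is l; raising it to j adds only zeros and makes the range
    independent of l, so the sums can be swapped.\<close>
  have B_sum: "mat_mult A B i l = (\<Sum>k\<le>j. A i k * B k l)" if "l \<le> j" for l
    unfolding mat_mult_upper_triangular [OF B]
    by (rule sum.mono_neutral_left) (use that B in \<open>auto simp: upper_triangular_def\<close>)
  have "mat_mult (mat_mult A B) C i j = (\<Sum>l\<le>j. (\<Sum>k\<le>j. A i k * B k l) * C l j)"
    by (simp add: mat_mult_upper_triangular [OF C] B_sum)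
  also have "\<dots> = (\<Sum>k\<le>j. A i k * (\<Sum>l\<le>j. B k l * C l j))"
    by (simp add: sum_distrib_left sum_distrib_right mult.assoc) (rule sum.swap)
  also have "\<dots> = mat_mult A (mat_mult B C) i j"
    by (simp add: mat_mult_upper_triangular upper_triangular_mat_mult B C)
  finally show "mat_mult (mat_mult A B) C i j = mat_mult A (mat_mult B C) i j" .
qed

lemma mat_mult_id_left: "upper_triangular A \<Longrightarrow> mat_mult mat_id A = A"
  by (intro ext) (auto simp: mat_mult_upper_triangular mat_id_def upper_triangular_def
      if_distrib [of "\<lambda>x. x * _"] cong: if_cong)

lemma mat_mult_id_right: "mat_mult A mat_id = A"
  unfolding mat_mult_upper_triangular [OF upper_triangular_mat_id]
  by (intro ext) (simp add: mat_id_def if_distrib [of "\<lambda>x. _ * x"] cong: if_cong)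

lemma mat_power_add:
  assumes "upper_triangular A"
  shows "mat_power A (p + q) = mat_mult (mat_power A p) (mat_power A q)"
  by (induction p)
    (simp_all add: mat_mult_id_left upper_triangular_mat_power mat_mult_assoc assms)

lemma mat_power_Suc_right:
  assumes "upper_triangular A"
  shows "mat_power A (Suc m) = mat_mult (mat_power A m) A"
  using mat_power_add [OF assms, of m 1] by (simp add: mat_mult_id_right)

section \<open>Power series evaluated at strictly upper triangular matrices\<close>

text \<open>The series \<open>F\<close> evaluated at \<open>M\<close>. Cutting off at k = j loses
  nothing for strictly upper triangular \<open>M\<close>, whose k-th power has zero (i, j) entry
  once k > j. Rational coefficients allow formal identities over the rationals to be carried over to
  matrices.\<close>

definition mat_fps :: "(rat \<Rightarrow> 'a::comm_ring_1) \<Rightarrow> rat fps \<Rightarrow> 'a matrix \<Rightarrow> 'a matrix" where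
  "mat_fps \<iota> F M = (\<lambda>i j. \<Sum>k\<le>j. \<iota> (fps_nth F k) * mat_power M k i j)"

lemma mat_fps_eq_sum:
  assumes "strictly_upper_triangular M" "j \<le> N"
  shows "mat_fps \<iota> F M i j = (\<Sum>k\<le>N. \<iota> (fps_nth F k) * mat_power M k i j)"
  unfolding mat_fps_def
  by (rule sum.mono_neutral_left) (use assms in \<open>auto simp: mat_power_eq_0\<close>)

lemma mat_fps_eq_Sum_any:
  assumes "strictly_upper_triangular M"
  shows "mat_fps \<iota> F M i j = Sum_any (\<lambda>k. \<iota> (fps_nth F k) * mat_power M k i j)"
  unfolding mat_fps_def
proof (rule Sum_any.expand_superset [symmetric])
  show "{k. \<iota> (fps_nth F k) * mat_power M k i j \<noteq> 0} \<subseteq> {..j}"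
  proof
    fix k
    assume "k \<in> {k. \<iota> (fps_nth F k) * mat_power M k i j \<noteq> 0}"
    then have "mat_power M k i j \<noteq> 0"
      by auto
    then have "\<not> j < i + k"
      using mat_power_eq_0 [OF assms] by blast
    then show "k \<in> {..j}"
      by simp
  qed
qed simp

lemma upper_triangular_mat_fps:
  assumes "strictly_upper_triangular M"
  shows "upper_triangular (mat_fps \<iota> F M)"
  using upper_triangular_mat_power [OF strictly_upper_triangular_imp_upper_triangular [OF assms]]
  by (simp add: mat_fps_def upper_triangular_def)

text \<open>The Cauchy product for truncated sums: the square exceeds the triangle only by terms
  with p + q > N. It serves both for matrices and for the flow.\<close>

lemma sum_triangle_eq_sum_square:
  fixes g :: "nat \<Rightarrow> nat \<Rightarrow> 'b::comm_monoid_add"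
  assumes "\<And>p q. N < p + q \<Longrightarrow> g p q = 0"
  shows "(\<Sum>k\<le>N. \<Sum>p\<le>k. g p (k - p)) = (\<Sum>p\<le>N. \<Sum>q\<le>N. g p q)"
proof -
  have "(\<Sum>k\<le>N. \<Sum>p\<le>k. g p (k - p)) = (\<Sum>(p, q)\<in>{(p, q). p + q \<le> N}. g p q)"
    by (rule sum.triangle_reindex_eq [symmetric])
  also have "\<dots> = (\<Sum>(p, q)\<in>{..N} \<times> {..N}. g p q)"
    by (rule sum.mono_neutral_left) (use assms in \<open>force simp: not_less [symmetric]\<close>)+
  also have "\<dots> = (\<Sum>p\<le>N. \<Sum>q\<le>N. g p q)"
    by (rule sum.cartesian_product [symmetric])
  finally show ?thesis .
qed

section \<open>Evaluation respects products and substitution\<close>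

context
  fixes \<iota> :: "rat \<Rightarrow> 'a::comm_ring_1"
  assumes \<iota>: "rat_subring \<iota>"
begin

lemma mat_fps_1: "strictly_upper_triangular M \<Longrightarrow> mat_fps \<iota> 1 M = mat_id"
  by (intro ext) (simp add: mat_fps_def rat_subring_0 [OF \<iota>] rat_subring_1 [OF \<iota>]
      if_distrib [of \<iota>] if_distrib [of "\<lambda>x. x * _"] cong: if_cong)

lemma mat_fps_X:
  assumes "strictly_upper_triangular M"
  shows "mat_fps \<iota> fps_X M = M"
proof (intro ext)
  fix i j
  \<comment> \<open>The bound \<open>Suc j\<close> ensures that k = 1 is in range even when j =
    0.\<close>
  have "mat_fps \<iota> fps_X M i j = (\<Sum>k\<le>Suc j. \<iota> (fps_nth fps_X k) * mat_power M k i j)"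
    by (rule mat_fps_eq_sum [OF assms]) simp
  also have "\<dots> = (\<Sum>k\<in>{1}. \<iota> (fps_nth fps_X k) * mat_power M k i j)"
    by (rule sum.mono_neutral_right) (auto simp: fps_X_def rat_subring_0 [OF \<iota>])
  also have "\<dots> = M i j"
    by (simp add: rat_subring_1 [OF \<iota>] mat_mult_id_right)
  finally show "mat_fps \<iota> fps_X M i j = M i j" .
qed

lemma mat_fps_mult:
  assumes M: "strictly_upper_triangular M"
  shows "mat_fps \<iota> (F * G) M = mat_mult (mat_fps \<iota> F M) (mat_fps \<iota> G M)"
proof (intro ext)
  fix i j
  note U = upper_triangular_mat_power [OF strictly_upper_triangular_imp_upper_triangular [OF M]]
  let ?F = "\<lambda>k. \<iota> (fps_nth F k)" and ?G = "\<lambda>k. \<iota> (fps_nth G k)"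
  have add: "mat_power M (p + q) i j = (\<Sum>l\<le>j. mat_power M p i l * mat_power M q l j)" for p q
    by (simp add: mat_power_add strictly_upper_triangular_imp_upper_triangular M
        mat_mult_upper_triangular U)
  have "mat_fps \<iota> (F * G) M i j = (\<Sum>k\<le>j. \<Sum>p\<le>k. ?F p * ?G (k - p) * mat_power M (p + (k - p)) i j)"
    by (simp add: mat_fps_def fps_mult_nth atLeast0AtMost rat_subring_sum [OF \<iota>]
        rat_subring_mult [OF \<iota>] sum_distrib_right)
  also have "\<dots> = (\<Sum>p\<le>j. \<Sum>q\<le>j. ?F p * ?G q * mat_power M (p + q) i j)"
    by (rule sum_triangle_eq_sum_square) (simp add: mat_power_eq_0 M)
  also have "\<dots> = (\<Sum>p\<le>j. \<Sum>q\<le>j. \<Sum>l\<le>j. (?F p * mat_power M p i l) * (?G q * mat_power M q l j))"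
    by (simp add: add sum_distrib_left mult_ac)
  also have "\<dots> = (\<Sum>p\<le>j. \<Sum>l\<le>j. \<Sum>q\<le>j. (?F p * mat_power M p i l) * (?G q * mat_power M q l j))"
    by (intro sum.cong refl sum.swap)
  also have "\<dots> = (\<Sum>l\<le>j. \<Sum>p\<le>j. \<Sum>q\<le>j. (?F p * mat_power M p i l) * (?G q * mat_power M q l j))"
    by (rule sum.swap)
  also have "\<dots> = (\<Sum>l\<le>j. mat_fps \<iota> F M i l * mat_fps \<iota> G M l j)"
    by (rule sum.cong) (simp_all add: mat_fps_eq_sum [OF M, of _ j] sum_product)
  also have "\<dots> = mat_mult (mat_fps \<iota> F M) (mat_fps \<iota> G M) i j"
    by (rule mat_mult_upper_triangular [symmetric, OF upper_triangular_mat_fps [OF M]])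
  finally show "mat_fps \<iota> (F * G) M i j = mat_mult (mat_fps \<iota> F M) (mat_fps \<iota> G M) i j" .
qed

lemma mat_fps_power:
  assumes "strictly_upper_triangular M"
  shows "mat_fps \<iota> (F ^ m) M = mat_power (mat_fps \<iota> F M) m"
  by (induction m) (simp_all add: mat_fps_1 mat_fps_mult assms)

lemma strictly_upper_triangular_mat_fps:
  assumes M: "strictly_upper_triangular M" and F: "fps_nth F 0 = 0"
  shows "strictly_upper_triangular (mat_fps \<iota> F M)"
proof -
  have "\<iota> (fps_nth F k) * mat_power M k i j = 0" if "j \<le> i" for i j k
    by (cases k) (use that F in \<open>simp_all add: rat_subring_0 [OF \<iota>] mat_power_eq_0 [OF M]
      del: mat_power.simps\<close>)
  then show ?thesis
    by (simp add: strictly_upper_triangular_def mat_fps_def)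
qed

text \<open>Since \<open>F\<close> has no constant term, F^m has order at least m, so only m \<le> j
  matters up to degree j. After swapping the sums, multiplicativity turns evaluated powers of
  \<open>F\<close> into matrix powers.\<close>

lemma mat_fps_compose:
  assumes M: "strictly_upper_triangular M" and F: "fps_nth F 0 = 0"
  shows "mat_fps \<iota> (G oo F) M = mat_fps \<iota> G (mat_fps \<iota> F M)"
proof (intro ext)
  fix i j
  have coeff: "fps_nth (G oo F) k = (\<Sum>m\<le>j. fps_nth G m * fps_nth (F ^ m) k)" if "k \<le> j" for k
    unfolding fps_compose_nth atLeast0AtMost
    by (rule sum.mono_neutral_left) (use that F in \<open>auto simp: startsby_zero_power_prefix\<close>)
  have "mat_fps \<iota> (G oo F) M i j =
      (\<Sum>k\<le>j. \<Sum>m\<le>j. \<iota> (fps_nth G m) * (\<iota> (fps_nth (F ^ m) k) * mat_power M k i j))"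
    by (simp add: mat_fps_def coeff rat_subring_sum [OF \<iota>] rat_subring_mult [OF \<iota>]
        sum_distrib_right mult.assoc)
  also have "\<dots> = (\<Sum>m\<le>j. \<iota> (fps_nth G m) * mat_fps \<iota> (F ^ m) M i j)"
    by (simp add: mat_fps_def sum_distrib_left) (rule sum.swap)
  also have "\<dots> = mat_fps \<iota> G (mat_fps \<iota> F M) i j"
    by (simp add: mat_fps_power [OF M]) (simp add: mat_fps_def)
  finally show "mat_fps \<iota> (G oo F) M i j = mat_fps \<iota> G (mat_fps \<iota> F M) i j" .
qed

section \<open>Matrix exponential and logarithm as evaluated series\<close>

lemma mat_exp_eq_mat_fps:
  assumes "strictly_upper_triangular M"
  shows "mat_exp \<iota> M = mat_fps \<iota> (fps_exp 1) M"
  by (intro ext) (simp add: mat_exp_def mat_fps_eq_Sum_any [OF assms])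

lemma mat_log_eq_mat_fps:
  assumes "strictly_upper_triangular (\<lambda>i j. A i j - mat_id i j)"
  shows "mat_log \<iota> A = mat_fps \<iota> (fps_ln 1) (\<lambda>i j. A i j - mat_id i j)"
proof -
  have "fps_nth (fps_ln 1) k = (if k \<ge> 1 then (- 1) ^ (k + 1) / of_nat k else (0 :: rat))" for k
    by (cases k) (simp_all add: fps_ln_nth)
  then show ?thesis
    by (intro ext) (auto simp: mat_log_def mat_fps_eq_Sum_any [OF assms]
        rat_subring_0 [OF \<iota>] simp del: power_Suc intro!: Sum_any.cong)
qed

lemma mat_log_mat_exp:
  assumes M: "strictly_upper_triangular M"
  shows "mat_log \<iota> (mat_exp \<iota> M) = M"
proof -
  let ?E = "fps_exp 1 - 1 :: rat fps"
  have E0: "fps_nth ?E 0 = 0" and E1: "fps_nth ?E 1 \<noteq> 0"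
    by simp_all
  have "\<iota> x = \<iota> (x - y) + \<iota> y" for x y
    by (simp flip: rat_subring_add [OF \<iota>])
  then have diff: "\<iota> (x - y) = \<iota> x - \<iota> y" for x y
    by (simp add: algebra_simps)
  have *: "(\<lambda>i j. mat_exp \<iota> M i j - mat_id i j) = mat_fps \<iota> ?E M"
    by (intro ext)
      (simp add: mat_exp_eq_mat_fps [OF M] mat_fps_1 [OF M, symmetric] mat_fps_def diff
        left_diff_distrib sum_subtractf)
  have "mat_log \<iota> (mat_exp \<iota> M) = mat_fps \<iota> (fps_ln 1) (mat_fps \<iota> ?E M)"
    using mat_log_eq_mat_fps [of "mat_exp \<iota> M"] strictly_upper_triangular_mat_fps [OF M E0]
    by (simp add: *)
  also have "\<dots> = mat_fps \<iota> (fps_ln 1 oo ?E) M"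
    by (rule mat_fps_compose [symmetric, OF M E0])
  \<comment> \<open>\<open>fps_ln 1\<close> is the compositional inverse of
    \<open>?E\<close>.\<close>
  also have "fps_ln 1 oo ?E = fps_X"
    using fps_inv [OF E0 E1] by (simp add: fps_ln_fps_exp_inv)
  finally show ?thesis
    by (simp add: mat_fps_X M)
qed

end

section \<open>The exponential of a derivation\<close>

definition fps_derivation :: "'a::comm_ring_1 fps \<Rightarrow> 'a fps \<Rightarrow> 'a fps" where
  "fps_derivation h a = h * fps_deriv a"

lemma fps_derivation_nth:
  "fps_nth (fps_derivation h a) i =
     (\<Sum>p\<le>i. fps_nth h p * (of_nat (i - p + 1) * fps_nth a (i - p + 1)))"
  by (simp add: fps_derivation_def fps_mult_nth atLeast0AtMost)

lemma fps_derivation_sum: "fps_derivation h (sum g A) = (\<Sum>a\<in>A. fps_derivation h (g a))"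
  by (induction A rule: infinite_finite_induct)
    (simp_all add: fps_derivation_def distrib_left)

lemma fps_derivation_mult:
  "fps_derivation h (a * b) = fps_derivation h a * b + a * fps_derivation h b"
  by (simp add: fps_derivation_def algebra_simps)

lemma fps_derivation_of_nat_mult:
  "fps_derivation h (of_nat m * a) = of_nat m * fps_derivation h a"
  by (simp add: fps_derivation_def algebra_simps)

text \<open>The higher Leibniz rule, by induction with Pascal's identity.\<close>

lemma fps_derivation_power_mult:
  "(fps_derivation h ^^ m) (a * b) =
     (\<Sum>k\<le>m. of_nat (m choose k) * ((fps_derivation h ^^ k) a * (fps_derivation h ^^ (m - k)) b))"
proof (induction m)
  case 0
  then show ?case by simp
next
  case (Suc m)
  let ?D = "\<lambda>k. fps_derivation h ^^ k"
  let ?t = "\<lambda>k. ?D k a * ?D (Suc m - k) b"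
  have "?D (Suc m) (a * b) =
      (\<Sum>k\<le>m. of_nat (m choose k) * (?D (Suc k) a * ?D (m - k) b + ?D k a * ?D (Suc (m - k)) b))"
    by (simp add: Suc.IH fps_derivation_sum fps_derivation_of_nat_mult
        fps_derivation_mult [of h "(_ ^^ _) _"])
  also have "\<dots> = (\<Sum>k\<le>m. of_nat (m choose k) * ?t (Suc k)) + (\<Sum>k\<le>m. of_nat (m choose k) * ?t k)"
    by (simp add: distrib_left sum.distrib Suc_diff_le)
  \<comment> \<open>The added summand at \<open>Suc m\<close> has binomial coefficient 0; it lets
    the shifted sum run over the same range as the other one.\<close>
  also have "(\<Sum>k\<le>m. of_nat (m choose k) * ?t k) = (\<Sum>k\<le>Suc m. of_nat (m choose k) * ?t k)"
    by (simp add: binomial_eq_0)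
  also have "\<dots> = ?t 0 + (\<Sum>k\<le>m. of_nat (m choose Suc k) * ?t (Suc k))"
    by (simp only: sum.atMost_Suc_shift) simp
  also have "(\<Sum>k\<le>m. of_nat (m choose k) * ?t (Suc k)) +
      (?t 0 + (\<Sum>k\<le>m. of_nat (m choose Suc k) * ?t (Suc k))) =
      ?t 0 + (\<Sum>k\<le>m. of_nat (Suc m choose Suc k) * ?t (Suc k))"
    by (simp add: algebra_simps sum.distrib)
  also have "\<dots> = (\<Sum>k\<le>Suc m. of_nat (Suc m choose k) * ?t k)"
    by (simp only: sum.atMost_Suc_shift) simp
  finally show ?case .
qed

text \<open>This is exp(h d/dz) applied to \<open>a\<close>, the operator E of the introduction. The
  cutoff at k = j is harmless when h has order at least 2.\<close>

definition fps_flow :: "(rat \<Rightarrow> 'a::comm_ring_1) \<Rightarrow> 'a fps \<Rightarrow> 'a fps \<Rightarrow> 'a fps" where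
  "fps_flow \<iota> h a = Abs_fps (\<lambda>j. \<Sum>k\<le>j. \<iota> (1 / fact k) * fps_nth ((fps_derivation h ^^ k) a) j)"

text \<open>Differentiation lowers the order by at most one and multiplication by h raises it by at
  least two, so each iterate gains at least one.\<close>

lemma fps_derivation_power_nth_eq_0:
  assumes h: "\<And>i. i < 2 \<Longrightarrow> fps_nth h i = 0" and "j < k"
  shows "fps_nth ((fps_derivation h ^^ k) a) j = 0"
  using \<open>j < k\<close>
proof (induction k arbitrary: j)
  case 0
  then show ?case by simp
next
  case (Suc k)
  show ?case
    unfolding funpow.simps comp_apply fps_derivation_nth
  proof (rule sum.neutral, intro ballI)
    fix p
    assume "p \<in> {..j}"
    then have "p < 2 \<or> j - p + 1 < k"
      using Suc.prems by auto
    then show "fps_nth h p * (of_nat (j - p + 1) *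
        fps_nth ((fps_derivation h ^^ k) a) (j - p + 1)) = 0"
      using h Suc.IH by auto
  qed
qed

lemma fps_flow_nth:
  assumes "\<And>i. i < 2 \<Longrightarrow> fps_nth h i = 0" and "j \<le> N"
  shows "fps_nth (fps_flow \<iota> h a) j =
    (\<Sum>k\<le>N. \<iota> (1 / fact k) * fps_nth ((fps_derivation h ^^ k) a) j)"
  unfolding fps_flow_def fps_nth_Abs_fps
  by (rule sum.mono_neutral_left)
    (use assms in \<open>auto simp: fps_derivation_power_nth_eq_0\<close>)

text \<open>The coefficient at z^j of the k-th iterate on z involves only h_p with p < j, except for
  k = 1, where it is h_j itself. This triangular dependence makes recursive solving
  possible.\<close>

lemma fps_derivation_power_X_nth_cong:
  fixes g h :: "'a::comm_ring_1 fps"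
  assumes g: "\<And>i. i < 2 \<Longrightarrow> fps_nth g i = 0" and h: "\<And>i. i < 2 \<Longrightarrow> fps_nth h i = 0"
    and eq: "\<And>i. i < j \<Longrightarrow> fps_nth g i = fps_nth h i"
    and i: "i < j \<or> i = j \<and> k \<noteq> 1"
  shows "fps_nth ((fps_derivation g ^^ k) fps_X) i = fps_nth ((fps_derivation h ^^ k) fps_X) i"
  using i
proof (induction k arbitrary: i)
  case 0
  then show ?case by simp
next
  case (Suc k)
  show ?case
    unfolding funpow.simps comp_apply fps_derivation_nth
  proof (rule sum.cong [OF refl])
    fix p
    assume "p \<in> {..i}"
    then have p: "p \<le> i"
      by simp
    let ?g = "fps_nth ((fps_derivation g ^^ k) fps_X)"
      and ?h = "fps_nth ((fps_derivation h ^^ k) fps_X)"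
    consider "p < 2" | "2 \<le> p" "p < j" | "2 \<le> p" "p = j" "i = j"
      using p Suc.prems by linarith
    then show "fps_nth g p * (of_nat (i - p + 1) * ?g (i - p + 1)) =
        fps_nth h p * (of_nat (i - p + 1) * ?h (i - p + 1))"
    proof cases
      case 1
      then show ?thesis by (simp add: g h)
    next
      case 2
      then have "i - p + 1 < j"
        using p Suc.prems by linarith
      then show ?thesis
        using 2 by (simp only: eq Suc.IH simp_thms)
    next
      case 3
      \<comment> \<open>Here the top coefficient at j would enter, multiplied by the coefficient of
        z in the k-th iterate. As k > 0, that iterate is a multiple of a series of order at least 2,
        so the factor is 0.\<close>
      then obtain l where k: "k = Suc l"
        using Suc.prems by (cases k) auto
      have "fps_nth (fps_derivation u a) 1 = 0" if "\<And>i. i < 2 \<Longrightarrow> fps_nth u i = 0"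
        for u a :: "'a fps"
        by (simp add: fps_derivation_nth that)
      then have "?g 1 = 0" "?h 1 = 0"
        using g h by (simp_all add: k)
      then show ?thesis
        using 3 by simp
    qed
  qed
qed

section \<open>Multiplicativity and inversion of the flow\<close>

context
  fixes \<iota> :: "rat \<Rightarrow> 'a::comm_ring_1"
  assumes \<iota>: "rat_subring \<iota>"
begin

lemma fps_flow_1: "fps_flow \<iota> h 1 = 1"
proof (rule fps_ext)
  have "(fps_derivation h ^^ k) 1 = (if k = 0 then 1 else 0)" for k
    by (induction k) (auto simp: fps_derivation_def)
  then show "fps_nth (fps_flow \<iota> h 1) j = fps_nth 1 j" for j
    by (simp add: fps_flow_def rat_subring_1 [OF \<iota>] if_distrib [of "\<lambda>a. fps_nth a _"]
        if_distrib [of "\<lambda>a. _ * a"] cong: if_cong)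
qed

text \<open>Dividing the Leibniz rule by k! splits the binomial coefficient into 1/p! and 1/(k -
  p)!, and the Cauchy product separates the two factors.\<close>

lemma fps_flow_mult:
  assumes h: "\<And>i. i < 2 \<Longrightarrow> fps_nth h i = 0"
  shows "fps_flow \<iota> h (a * b) = fps_flow \<iota> h a * fps_flow \<iota> h b"
proof (rule fps_ext)
  fix j
  let ?D = "\<lambda>k. fps_derivation h ^^ k"
  let ?c = "\<lambda>k. \<iota> (1 / fact k)"
  let ?g = "\<lambda>p q. ?c p * ?c q * fps_nth (?D p a * ?D q b) j"
  have choose: "?c k * of_nat (k choose p) = ?c p * ?c (k - p)" if "p \<le> k" for k p
    using that
    by (simp add: binomial_fact rat_subring_of_nat [OF \<iota>, symmetric]
        rat_subring_mult [OF \<iota>, symmetric])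
  have step: "?c k * fps_nth (?D k (a * b)) j = (\<Sum>p\<le>k. ?g p (k - p))" for k
  proof -
    have "?c k * fps_nth (?D k (a * b)) j =
        (\<Sum>p\<le>k. ?c k * of_nat (k choose p) * fps_nth (?D p a * ?D (k - p) b) j)"
      by (simp add: fps_derivation_power_mult fps_sum_nth sum_distrib_left mult.assoc
          flip: fps_of_nat)
    also have "\<dots> = (\<Sum>p\<le>k. ?g p (k - p))"
      by (rule sum.cong) (simp_all add: choose)
    finally show ?thesis .
  qed
  have vanish: "?g p q = 0" if "j < p + q" for p q
  proof -
    \<comment> \<open>From p + q > j follows s < p or j - s < q, so one of the factors lies below
      its order.\<close>
    have "fps_nth (?D p a) s * fps_nth (?D q b) (j - s) = 0" if "s \<le> j" for s
      using fps_derivation_power_nth_eq_0 [OF h, where j = s and k = p]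
        fps_derivation_power_nth_eq_0 [OF h, where j = "j - s" and k = q]
        \<open>j < p + q\<close> that by (cases "s < p") auto
    then show ?thesis
      by (simp add: fps_mult_nth)
  qed
  have "fps_nth (fps_flow \<iota> h (a * b)) j = (\<Sum>k\<le>j. \<Sum>p\<le>k. ?g p (k - p))"
    by (simp only: fps_flow_def fps_nth_Abs_fps step)
  also have "\<dots> = (\<Sum>p\<le>j. \<Sum>q\<le>j. ?g p q)"
    by (rule sum_triangle_eq_sum_square) (rule vanish)
  also have "\<dots> = (\<Sum>p\<le>j. \<Sum>q\<le>j. \<Sum>s\<le>j.
      (?c p * fps_nth (?D p a) s) * (?c q * fps_nth (?D q b) (j - s)))"
    by (simp add: fps_mult_nth atLeast0AtMost sum_distrib_left mult_ac)
  also have "\<dots> = (\<Sum>p\<le>j. \<Sum>s\<le>j. \<Sum>q\<le>j.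
      (?c p * fps_nth (?D p a) s) * (?c q * fps_nth (?D q b) (j - s)))"
    by (intro sum.cong refl sum.swap)
  also have "\<dots> = (\<Sum>s\<le>j. \<Sum>p\<le>j. \<Sum>q\<le>j.
      (?c p * fps_nth (?D p a) s) * (?c q * fps_nth (?D q b) (j - s)))"
    by (rule sum.swap)
  also have "\<dots> = (\<Sum>s\<le>j. fps_nth (fps_flow \<iota> h a) s * fps_nth (fps_flow \<iota> h b) (j - s))"
    by (rule sum.cong)
      (simp_all add: fps_flow_nth [of h _ j, OF h] sum_product)
  also have "\<dots> = fps_nth (fps_flow \<iota> h a * fps_flow \<iota> h b) j"
    by (simp add: fps_mult_nth atLeast0AtMost)
  finally show "fps_nth (fps_flow \<iota> h (a * b)) j = fps_nth (fps_flow \<iota> h a * fps_flow \<iota> h b) j" .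
qed

lemma fps_flow_power:
  assumes "\<And>i. i < 2 \<Longrightarrow> fps_nth h i = 0"
  shows "fps_flow \<iota> h (a ^ m) = fps_flow \<iota> h a ^ m"
  by (induction m) (simp_all add: fps_flow_1 fps_flow_mult assms)

text \<open>Below j the two series agree, so in degree j the flows can differ only in the term k =
  1, which contributes the j-th coefficients of g and h.\<close>

lemma fps_flow_X_nth_diff:
  assumes g: "\<And>i. i < 2 \<Longrightarrow> fps_nth g i = 0" and h: "\<And>i. i < 2 \<Longrightarrow> fps_nth h i = 0"
    and eq: "\<And>i. i < j \<Longrightarrow> fps_nth g i = fps_nth h i"
  shows "fps_nth (fps_flow \<iota> g fps_X) j - fps_nth (fps_flow \<iota> h fps_X) j =
    fps_nth g j - fps_nth h j"
proof -
  let ?d = "\<lambda>k. \<iota> (1 / fact k) * fps_nth ((fps_derivation g ^^ k) fps_X) j -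
      \<iota> (1 / fact k) * fps_nth ((fps_derivation h ^^ k) fps_X) j"
  have "fps_nth (fps_flow \<iota> g fps_X) j - fps_nth (fps_flow \<iota> h fps_X) j = (\<Sum>k\<le>Suc j. ?d k)"
    by (simp only: fps_flow_nth [of g j "Suc j", OF g] fps_flow_nth [of h j "Suc j", OF h]
        le_SucI le_refl sum_subtractf)
  also have "\<dots> = (\<Sum>k\<in>{1}. ?d k)"
  proof (rule sum.mono_neutral_right)
    show "\<forall>k\<in>{..Suc j} - {1}. ?d k = 0"
      using fps_derivation_power_X_nth_cong [OF g h eq, of j j] by auto
  qed auto
  also have "\<dots> = fps_nth g j - fps_nth h j"
    by (simp add: fps_derivation_def rat_subring_1 [OF \<iota>])
  finally show ?thesis .
qed

lemma fps_flow_0: "fps_flow \<iota> 0 fps_X = fps_X"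
proof (rule fps_ext)
  have "(fps_derivation 0 ^^ k) fps_X = (if k = 0 then fps_X else (0 :: 'a fps))" for k
    by (induction k) (auto simp: fps_derivation_def)
  then show "fps_nth (fps_flow \<iota> 0 fps_X) j = fps_nth fps_X j" for j
    by (simp add: fps_flow_def rat_subring_1 [OF \<iota>] if_distrib [of "\<lambda>a. fps_nth a _"]
        if_distrib [of "\<lambda>a. _ * a"] cong: if_cong)
qed

text \<open>Comparison with the zero series, whose flow fixes z: if h vanishes below j, then E z - z
  has j-th coefficient h_j. The two orders therefore agree.\<close>

lemma fps_X_power_dvd_fps_flow_iff:
  assumes h: "\<And>i. i < 2 \<Longrightarrow> fps_nth h i = 0"
  shows "fps_X ^ m dvd fps_flow \<iota> h fps_X - fps_X \<longleftrightarrow> fps_X ^ m dvd h"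
proof -
  have nth: "fps_nth (fps_flow \<iota> h fps_X - fps_X) j = fps_nth h j"
    if "\<And>i. i < j \<Longrightarrow> fps_nth h i = 0" for j
    using fps_flow_X_nth_diff [of h 0 j] h that by (simp add: fps_flow_0)
  show ?thesis
    unfolding fps_X_power_dvd_iff
  proof (intro iffI allI impI)
    fix i
    assume "\<forall>i<m. fps_nth h i = 0" "i < m"
    then show "fps_nth (fps_flow \<iota> h fps_X - fps_X) i = 0"
      using nth [of i] by simp
  next
    fix i
    assume f: "\<forall>i<m. fps_nth (fps_flow \<iota> h fps_X - fps_X) i = 0" and "i < m"
    then show "fps_nth h i = 0"
      by (induction i rule: less_induct) (metis nth order.strict_trans)
  qed
qed

text \<open>
  The coefficients of the solution \<open>h\<close> of \<open>fps_flow \<iota> h fps_X = f\<close>. The defect of the truncated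
  solution at \<open>j\<close> is exactly the missing coefficient.
\<close>

fun fps_flow_generator :: "'a fps \<Rightarrow> nat \<Rightarrow> 'a" where
  "fps_flow_generator f j =
     (if j < 2 then 0
      else fps_nth f j - fps_nth (fps_flow \<iota>
        (Abs_fps (\<lambda>i. if i < j then fps_flow_generator f i else 0)) fps_X) j)"

declare fps_flow_generator.simps [simp del]

lemma fps_flow_surj:
  assumes f: "fps_X ^ 2 dvd f - fps_X"
  obtains h where "fps_X ^ 2 dvd h" "fps_flow \<iota> h fps_X = f"
proof
  let ?h = "Abs_fps (fps_flow_generator f)"
  have h: "fps_nth ?h i = 0" if "i < 2" for i
    using that by (simp add: fps_flow_generator.simps)
  then show dvd: "fps_X ^ 2 dvd ?h"
    by (simp add: fps_X_power_dvd_iff)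
  show "fps_flow \<iota> ?h fps_X = f"
  proof (rule fps_ext)
    fix j
    show "fps_nth (fps_flow \<iota> ?h fps_X) j = fps_nth f j"
    proof (cases "j < 2")
      case True
      \<comment> \<open>In degrees 0 and 1 both f and the flow agree with z.\<close>
      have "fps_X ^ 2 dvd fps_flow \<iota> ?h fps_X - fps_X"
        using dvd fps_X_power_dvd_fps_flow_iff [OF h] by blast
      then have "fps_nth (fps_flow \<iota> ?h fps_X - fps_X) j = fps_nth (f - fps_X) j"
        using f True by (simp only: fps_X_power_dvd_iff)
      then show ?thesis by simp
    next
      case False
      \<comment> \<open>The truncation agrees with \<open>?h\<close> below j and has j-th
        coefficient 0, so the flows differ at j by the coefficient that the recursion chose.\<close>
      let ?g = "Abs_fps (\<lambda>i. if i < j then fps_flow_generator f i else 0)"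
      have "fps_nth (fps_flow \<iota> ?h fps_X) j - fps_nth (fps_flow \<iota> ?g fps_X) j =
          fps_nth ?h j - fps_nth ?g j"
        by (rule fps_flow_X_nth_diff) (use h in auto)
      moreover have "fps_nth ?h j = fps_nth f j - fps_nth (fps_flow \<iota> ?g fps_X) j"
        using False by (simp add: fps_flow_generator.simps [of f j])
      ultimately show ?thesis by simp
    qed
  qed
qed

section \<open>Iteration matrices\<close>

text \<open>Multiplying a row of coefficients on the right by the matrix applies h d/dz to the
  series, and the ratios of \<open>\<Omega>\<close> telescope. Hence the new factor is split off on
  the right.\<close>

lemma mat_power_inf_iteration_matrix:
  assumes \<Omega>: "reference_sequence \<Omega>" and h: "fps_nth h 0 = 0"
  shows "mat_power (inf_iteration_matrix \<iota> \<Omega> h) k i j =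
    \<iota> (\<Omega> i / \<Omega> j) * fps_nth ((fps_derivation h ^^ k) (fps_X ^ i)) j"
proof (induction k arbitrary: i j)
  case 0
  show ?case
    using \<Omega> by (simp add: mat_id_def reference_sequence_def rat_subring_1 [OF \<iota>])
next
  case (Suc k)
  let ?M = "inf_iteration_matrix \<iota> \<Omega> h"
  let ?a = "(fps_derivation h ^^ k) (fps_X ^ i)"
  have U: "upper_triangular ?M"
    by (simp add: upper_triangular_def inf_iteration_matrix_def)
  have scale: "\<iota> (\<Omega> i / \<Omega> l) * \<iota> (\<Omega> l / \<Omega> j) = \<iota> (\<Omega> i / \<Omega> j)" for l
    using \<Omega> by (simp add: reference_sequence_def flip: rat_subring_mult [OF \<iota>])
  let ?t = "\<lambda>l. of_nat l * fps_nth ?a l * fps_nth h (j - l + 1)"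
  have term_eq: "(\<iota> (\<Omega> i / \<Omega> l) * fps_nth ?a l) * ?M l j = \<iota> (\<Omega> i / \<Omega> j) * ?t l" if "l \<le> j" for l
    unfolding scale [of l, symmetric] using that by (simp add: inf_iteration_matrix_def mult_ac)
  have "mat_power ?M (Suc k) i j = (\<Sum>l\<le>j. (\<iota> (\<Omega> i / \<Omega> l) * fps_nth ?a l) * ?M l j)"
    by (simp only: mat_power_Suc_right [OF U] mat_mult_upper_triangular [OF U] Suc.IH)
  also have "\<dots> = \<iota> (\<Omega> i / \<Omega> j) * (\<Sum>l\<le>j. ?t l)"
    by (simp add: term_eq sum_distrib_left)
  \<comment> \<open>The extra term l = \<open>Suc j\<close> carries the factor h_0 = 0; the shift
    that follows drops l = 0, which carries the factor \<open>of_nat 0\<close>.\<close>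
  also have "(\<Sum>l\<le>j. ?t l) = (\<Sum>l\<le>Suc j. of_nat l * fps_nth ?a l * fps_nth h (Suc j - l))"
    using h by (simp add: Suc_diff_le)
  also have "\<dots> = (\<Sum>l\<le>j. of_nat (Suc l) * fps_nth ?a (Suc l) * fps_nth h (j - l))"
    by (simp only: sum.atMost_Suc_shift) simp
  also have "\<dots> = fps_nth (fps_deriv ?a * h) j"
    by (simp add: fps_mult_nth atLeast0AtMost)
  also have "fps_deriv ?a * h = (fps_derivation h ^^ Suc k) (fps_X ^ i)"
    by (simp add: fps_derivation_def mult.commute)
  finally show ?case .
qed

lemma strictly_upper_triangular_inf_iteration_matrix:
  assumes "fps_nth h 1 = 0"
  shows "strictly_upper_triangular (inf_iteration_matrix \<iota> \<Omega> h)"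
  using assms by (auto simp: strictly_upper_triangular_def inf_iteration_matrix_def)

text \<open>Row i of the exponential is the flow of z^i, which by multiplicativity is the i-th power
  of the flow of z.\<close>

lemma mat_exp_inf_iteration_matrix:
  assumes \<Omega>: "reference_sequence \<Omega>" and h: "fps_X ^ 2 dvd h"
  shows "mat_exp \<iota> (inf_iteration_matrix \<iota> \<Omega> h) =
    iteration_matrix \<iota> \<Omega> (fps_flow \<iota> h fps_X)"
proof -
  have h0: "fps_nth h i = 0" if "i < 2" for i
    using h that by (simp add: fps_X_power_dvd_iff)
  have f0: "fps_nth (fps_flow \<iota> h fps_X) 0 = 0"
    by (simp add: fps_flow_def)
  have pow: "fps_flow \<iota> h fps_X ^ i = fps_flow \<iota> h (fps_X ^ i)" for i
    by (simp add: fps_flow_power h0)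
  show ?thesis
    unfolding iteration_matrix_eq [OF \<iota> \<Omega> f0] pow
    by (intro ext)
      (simp add: mat_exp_eq_mat_fps [OF \<iota>] strictly_upper_triangular_inf_iteration_matrix h0
        mat_fps_def mat_power_inf_iteration_matrix [OF \<Omega>] fps_flow_def sum_distrib_left mult_ac)
qed

section \<open>Exponential and logarithm between the two families\<close>

lemma mat_exp_image_inf_iteration_matrices:
  assumes \<Omega>: "reference_sequence \<Omega>" and n: "n > 0"
  shows "mat_exp \<iota> ` inf_iteration_matrices \<iota> \<Omega> n = iteration_matrices \<iota> \<Omega> n"
proof (intro equalityI subsetI)
  have dvd_2: "fps_X ^ 2 dvd a" if "fps_X ^ (n + 1) dvd a" for a :: "'a fps"
    using dvd_trans [OF le_imp_power_dvd that] n by simp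
  have iff: "fps_X ^ m dvd fps_flow \<iota> h fps_X - fps_X \<longleftrightarrow> fps_X ^ m dvd h"
    if "fps_X ^ 2 dvd h" for h m
    by (rule fps_X_power_dvd_fps_flow_iff) (use that in \<open>simp add: fps_X_power_dvd_iff\<close>)
  fix A
  {
    assume "A \<in> mat_exp \<iota> ` inf_iteration_matrices \<iota> \<Omega> n"
    then obtain h where h: "fps_X ^ (n + 1) dvd h"
      and A: "A = mat_exp \<iota> (inf_iteration_matrix \<iota> \<Omega> h)"
      by (auto simp: inf_iteration_matrices_def)
    have "A = iteration_matrix \<iota> \<Omega> (fps_flow \<iota> h fps_X)"
      unfolding A by (rule mat_exp_inf_iteration_matrix [OF \<Omega> dvd_2 [OF h]])
    then show "A \<in> iteration_matrices \<iota> \<Omega> n"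
      using h iff [OF dvd_2 [OF h]] unfolding iteration_matrices_def by blast
  next
    assume "A \<in> iteration_matrices \<iota> \<Omega> n"
    then obtain f where f: "fps_X ^ (n + 1) dvd f - fps_X" and A: "A = iteration_matrix \<iota> \<Omega> f"
      by (auto simp: iteration_matrices_def)
    obtain h where h: "fps_X ^ 2 dvd h" and hf: "fps_flow \<iota> h fps_X = f"
      using fps_flow_surj [OF dvd_2 [OF f]] .
    \<comment> \<open>The solution was only known to have order at least 2; the equality of orders
      improves this to n + 1.\<close>
    have "fps_X ^ (n + 1) dvd h"
      using f iff [OF h] hf by blast
    moreover have "A = mat_exp \<iota> (inf_iteration_matrix \<iota> \<Omega> h)"
      unfolding mat_exp_inf_iteration_matrix [OF \<Omega> h] hf A ..
    ultimately show "A \<in> mat_exp \<iota> ` inf_iteration_matrices \<iota> \<Omega> n"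
      unfolding inf_iteration_matrices_def by blast
  }
qed

lemma strictly_upper_triangular_inf_iteration_matrices:
  assumes n: "n > 0" and M: "M \<in> inf_iteration_matrices \<iota> \<Omega> n"
  shows "strictly_upper_triangular M"
proof -
  obtain h where "fps_X ^ (n + 1) dvd h" and M: "M = inf_iteration_matrix \<iota> \<Omega> h"
    using M by (auto simp: inf_iteration_matrices_def)
  then have "fps_nth h 1 = 0"
    unfolding fps_X_power_dvd_iff using n by simp
  then show ?thesis
    unfolding M by (rule strictly_upper_triangular_inf_iteration_matrix)
qed

end

theorem theorem4p3:
  fixes \<iota> :: "rat \<Rightarrow> 'a::comm_ring_1" and \<Omega> :: "nat \<Rightarrow> rat" and n :: nat
  assumes "rat_subring \<iota>"
    and "reference_sequence \<Omega>"
    and "n > 0"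
  shows "mat_exp \<iota> ` inf_iteration_matrices \<iota> \<Omega> n = iteration_matrices \<iota> \<Omega> n
    \<and> mat_log \<iota> ` iteration_matrices \<iota> \<Omega> n = inf_iteration_matrices \<iota> \<Omega> n"
proof
  show exp: "mat_exp \<iota> ` inf_iteration_matrices \<iota> \<Omega> n = iteration_matrices \<iota> \<Omega> n"
    by (rule mat_exp_image_inf_iteration_matrices [OF assms])
  \<comment> \<open>A left inverse suffices, since the first part presents every matrix of the
    second family as an exponential.\<close>
  have "mat_log \<iota> (mat_exp \<iota> M) = M" if "M \<in> inf_iteration_matrices \<iota> \<Omega> n" for M
    using mat_log_mat_exp [OF assms(1)]
      strictly_upper_triangular_inf_iteration_matrices [OF assms(1,3) that] by blast
  then show "mat_log \<iota> ` iteration_matrices \<iota> \<Omega> n = inf_iteration_matrices \<iota> \<Omega> n"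
    by (simp add: exp [symmetric] image_image)
qed

end
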